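(* Let $\mathfrak R$ be a complete, separated topological ring with a base of neighborhoods of zero formed by open right ideals, and let $\mathfrak H\subset\mathfrak R$ be a closed left ideal. Then $\mathfrak H$ is topologically left T-nilpotent (in the topology induced from $\mathfrak R$) if and only if for any nonzero left $\mathfrak R$-contramodule $\mathfrak C$ one has $\mathfrak H\rightthreetimes\mathfrak C\ne\mathfrak C$, i.e., the restriction $\mathfrak H[[\mathfrak C]]\to\mathfrak C$ of the contraaction map is not surjective.
   Context: Rings are associative with unit. All topological abelian groups/rings have a base of neighborhoods of zero consisting of open subgroups; such a group $A$ is separated (resp. complete) if $A\to\varprojlim_U A/U$ ($U$ ranging over open subgroups) is injective (resp. surjective). For a complete, separated topological abelian group $\mathfrak A$ and a set $X$, $\mathfrak A[[X]]$ is the group of formal linear combinations $\sum_{x\in X}a_xx$ with $a_x\in\mathfrak A$ such that for every open subgroup $\mathfrak U\subset\mathfrak A$ one has $a_x\in\mathfrak U$ for all but finitely many $x$. A map $f\colon X\to Y$ induces $\mathfrak A[[f]]\colon\sum_x a_xx\mapsto\sum_y(\sum_{f(x)=y}a_x)y$ (sums are limits of finite partial sums). Let $\mathfrak R$ be a complete, separated topological ring with a base of neighborhoods of zero formed by open right ideals. The functor $X\mapsto\mathfrak R[[X]]$ is a monad on the category of sets, with unit $\epsilon_X\colon x\mapsto 1\cdot x$ and multiplication $\phi_X\colon\mathfrak R[[\mathfrak R[[X]]]]\to\mathfrak R[[X]]$ opening parentheses: $\sum_y r_yy\mapsto\sum_x(\sum_y r_ys_{y,x})x$ where $y=\sum_xs_{y,x}x$.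 A left $\mathfrak R$-contramodule is an algebra over this monad: a set $\mathfrak C$ with a contraaction map $\pi_{\mathfrak C}\colon\mathfrak R[[\mathfrak C]]\to\mathfrak C$ such that $\pi_{\mathfrak C}\epsilon_{\mathfrak C}=\mathrm{id}$ and $\pi_{\mathfrak C}\circ\phi_{\mathfrak C}=\pi_{\mathfrak C}\circ\mathfrak R[[\pi_{\mathfrak C}]]$. Such a $\mathfrak C$ has an underlying left $\mathfrak R$-module structure. For a closed additive subgroup $\mathfrak A\subset\mathfrak R$, $\mathfrak A\rightthreetimes\mathfrak C\subset\mathfrak C$ denotes the image of $\mathfrak A[[\mathfrak C]]\subset\mathfrak R[[\mathfrak C]]$ under $\pi_{\mathfrak C}$. $\mathfrak H$ is topologically left T-nilpotent if for any sequence $a_1,a_2,a_3,\dots$ in $\mathfrak H$ the sequence $a_1,\ a_1a_2,\ a_1a_2a_3,\dots$ converges to zero. *)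

theory Defs
  imports "HOL-Analysis.Analysis"
begin

section \<open>Topological abelian groups and rings\<close>

text \<open>Associative topological rings with unit. The sort \<^class>\<open>ring_1\<close> is not used, because it
  would exclude the zero ring.\<close>

class topological_unital_ring =
  ring + monoid_mult + topological_ab_group_add + topological_semigroup_mult

definition add_subgroup :: "'a::ab_group_add set \<Rightarrow> bool" where
  "add_subgroup A \<longleftrightarrow> 0 \<in> A \<and> (\<forall>x\<in>A. \<forall>y\<in>A. x + y \<in> A) \<and> (\<forall>x\<in>A. - x \<in> A)"

definition left_ideal :: "'r::ring set \<Rightarrow> bool" where
  "left_ideal I \<longleftrightarrow> add_subgroup I \<and> (\<forall>r. \<forall>x\<in>I. r * x \<in> I)"

definition right_ideal :: "'r::ring set \<Rightarrow> bool" where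
  "right_ideal I \<longleftrightarrow> add_subgroup I \<and> (\<forall>r. \<forall>x\<in>I. x * r \<in> I)"

text \<open>In this section \<open>A\<close> is a subgroup of the ambient group, with the induced topology.\<close>

definition open_subgroups :: "'a::{topological_space, ab_group_add} set \<Rightarrow> 'a set set" where
  "open_subgroups A = {U. add_subgroup U \<and> openin (top_of_set A) U}"

abbreviation coset :: "'a::ab_group_add \<Rightarrow> 'a set \<Rightarrow> 'a set" where
  "coset a U \<equiv> (+) a ` U"

text \<open>The limit of the quotients \<open>A/U\<close>, as a set of families of cosets indexed by \<open>U\<close>. The
  transition map \<open>A/U \<rightarrow> A/V\<close> for \<open>U \<subseteq> V\<close> sends a coset of \<open>U\<close> to the coset of \<open>V\<close> containing it.\<close>

definition quotient_limit ::
    "'a::{topological_space, ab_group_add} set \<Rightarrow> ('a set \<Rightarrow> 'a set) set" where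
  "quotient_limit A =
    {c \<in> (\<Pi>\<^sub>E U\<in>open_subgroups A. (\<lambda>a. coset a U) ` A).
      \<forall>U\<in>open_subgroups A. \<forall>V\<in>open_subgroups A. U \<subseteq> V \<longrightarrow> c U \<subseteq> c V}"

definition to_quotient_limit ::
    "'a::{topological_space, ab_group_add} set \<Rightarrow> 'a \<Rightarrow> 'a set \<Rightarrow> 'a set" where
  "to_quotient_limit A a = restrict (coset a) (open_subgroups A)"

definition separated :: "'a::{topological_space, ab_group_add} set \<Rightarrow> bool" where
  "separated A \<longleftrightarrow> inj_on (to_quotient_limit A) A"

definition complete_group :: "'a::{topological_space, ab_group_add} set \<Rightarrow> bool" where
  "complete_group A \<longleftrightarrow> to_quotient_limit A ` A = quotient_limit A"

text \<open>The argument only serves to pick the type of the ring.\<close>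

definition base_of_open_right_ideals :: "'r::topological_unital_ring itself \<Rightarrow> bool" where
  "base_of_open_right_ideals _ \<longleftrightarrow>
    (\<forall>W::'r set. open W \<and> 0 \<in> W \<longrightarrow> (\<exists>I. right_ideal I \<and> open I \<and> I \<subseteq> W))"

text \<open>The sequence of products is \<open>a 0, a 0 * a 1, a 0 * a 1 * a 2, \<dots>\<close>\<close>

definition topologically_left_T_nilpotent :: "'r::topological_unital_ring set \<Rightarrow> bool" where
  "topologically_left_T_nilpotent H \<longleftrightarrow>
    (\<forall>a::nat \<Rightarrow> 'r. range a \<subseteq> H \<longrightarrow>
      limitin (top_of_set H) (\<lambda>n. prod_list (map a [0..<Suc n])) 0 sequentially)"


section \<open>Formal linear combinations and contramodules\<close>

text \<open>The set \<open>A[[X]]\<close>: a combination is represented by its function of coefficients, extended by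
  zero outside of the set \<open>X\<close>.\<close>

definition formal_combs ::
    "'a::{topological_space, ab_group_add} set \<Rightarrow> 'x set \<Rightarrow> ('x \<Rightarrow> 'a) set" where
  "formal_combs A X =
    {a. (\<forall>x\<in>X. a x \<in> A) \<and> (\<forall>x. x \<notin> X \<longrightarrow> a x = 0) \<and>
        (\<forall>U\<in>open_subgroups A. finite {x\<in>X. a x \<notin> U})}"

text \<open>The monad structure on \<open>X \<mapsto> R[[X]]\<close>. The constant \<^const>\<open>infsum\<close> is the limit of the finite
  partial sums, and is the reason for the sort \<^class>\<open>t2_space\<close>. That sort is no restriction: it
  follows from \<^const>\<open>separated\<close> when zero has a base of neighborhoods formed by subgroups.\<close>

definition comb_map ::
    "'x set \<Rightarrow> ('x \<Rightarrow> 'y) \<Rightarrow> ('x \<Rightarrow> 'r::{topological_unital_ring, t2_space}) \<Rightarrow> 'y \<Rightarrow> 'r" where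
  "comb_map X f a = (\<lambda>y. infsum a {x\<in>X. f x = y})"

definition comb_unit :: "'x \<Rightarrow> 'x \<Rightarrow> 'r::topological_unital_ring" where
  "comb_unit x = (\<lambda>x'. if x' = x then 1 else 0)"

definition comb_mult ::
    "'x set \<Rightarrow> (('x \<Rightarrow> 'r) \<Rightarrow> 'r) \<Rightarrow> 'x \<Rightarrow> 'r::{topological_unital_ring, t2_space}" where
  "comb_mult X r = (\<lambda>x. \<Sum>\<^sub>\<infinity>y\<in>formal_combs UNIV X. r y * y x)"

text \<open>Left contramodules with carrier \<open>C\<close> and contraaction map \<open>p\<close>; only the values of \<open>p\<close> on
  \<open>R[[C]]\<close> matter.\<close>

definition left_contramodule ::
    "'c set \<Rightarrow> (('c \<Rightarrow> 'r::{topological_unital_ring, t2_space}) \<Rightarrow> 'c) \<Rightarrow> bool" where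
  "left_contramodule C p \<longleftrightarrow>
    p \<in> formal_combs UNIV C \<rightarrow> C \<and>
    (\<forall>x\<in>C. p (comb_unit x) = x) \<and>
    (\<forall>r\<in>formal_combs UNIV (formal_combs UNIV C).
      p (comb_mult C r) = p (comb_map (formal_combs UNIV C) p r))"

text \<open>The zero element of a contramodule is the value of the contraaction at the zero combination.\<close>

definition nonzero_contramodule :: "'c set \<Rightarrow> (('c \<Rightarrow> 'r::zero) \<Rightarrow> 'c) \<Rightarrow> bool" where
  "nonzero_contramodule C p \<longleftrightarrow> C \<noteq> {p (\<lambda>_. 0)}"

definition contra_image ::
    "'r::{topological_space, ab_group_add} set \<Rightarrow> 'c set \<Rightarrow> (('c \<Rightarrow> 'r) \<Rightarrow> 'c) \<Rightarrow> 'c set" where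
  "contra_image A C p = p ` formal_combs A C"

text \<open>A formula cannot quantify over types, so "any contramodule" has to range over the
  contramodules whose carrier is a subset of some type, and that type must not be too small: over
  a one-element type every contramodule is zero. The type below has an arbitrary parameter \<open>'c\<close>, so
  a statement about it for all \<open>'c\<close> covers, up to isomorphism, the contramodules on any type
  whatsoever. The second summand makes it contain copies of all quotient sets of \<open>R[[nat]]\<close>, hence
  of all countably generated contramodules, whatever \<open>'c\<close> is.\<close>

type_synonym ('c, 'r) carrier_type = "'c + (nat \<Rightarrow> 'r)"

end

theory Submission
  imports Defs
begin

text \<open>If \<open>H\<close> is T-nilpotent and the contraaction maps \<open>H[[C]]\<close> onto \<open>C\<close>, choose \<open>h x \<in> H[[C]]\<close> over each
  \<open>x \<in> C\<close> and regard \<open>h\<close> as an infinite matrix. By Koenig's lemma the products of entries of \<open>h\<close> along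
  all finite paths starting at \<open>c\<close> form a zero-convergent family, so the row \<open>A = \<Sum>\<^sub>n c h\<^sup>n\<close> exists and
  satisfies \<open>A - A h = c\<close>. Since \<open>h x\<close> and \<open>x\<close> have the same image in \<open>C\<close>, the contraaction sends
  \<open>A - A h\<close> to zero, so \<open>c = 0\<close>.

  Conversely, for a sequence \<open>a\<close> in \<open>H\<close> let \<open>C\<close> be the quotient of \<open>R[[nat]]\<close> by the combinations of the
  relations \<open>e\<^sub>n = a\<^sub>n e\<^sub>n\<^sub>+\<^sub>1\<close>. These relations show that \<open>H[[C]]\<close> maps onto \<open>C\<close>, hence \<open>C = 0\<close> and
  \<open>e\<^sub>0 = \<Sum>\<^sub>n k\<^sub>n (e\<^sub>n - a\<^sub>n e\<^sub>n\<^sub>+\<^sub>1)\<close> for a zero-convergent \<open>k\<close>. Comparing coefficients gives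
  \<open>k\<^sub>n = a\<^sub>0 \<cdots> a\<^sub>n\<^sub>-\<^sub>1\<close>.\<close>

section \<open>Zero-convergent families and their sums\<close>

text \<open>Under \<open>base_of_open_right_ideals\<close> these form a base at zero, and they
  absorb right factors.\<close>

definition open_right_ideal :: "'r::topological_unital_ring set \<Rightarrow> bool" where
  "open_right_ideal U \<longleftrightarrow> right_ideal U \<and> open U"

text \<open>The finiteness condition of \<open>R[[S]]\<close>, tested on open right ideals only;
  \<open>formal_combs_iff\<close> relates the two forms. Values outside of \<open>S\<close> are
  ignored.\<close>

definition zero_convergent :: "('x \<Rightarrow> 'r::topological_unital_ring) \<Rightarrow> 'x set \<Rightarrow> bool" where
  "zero_convergent f S \<longleftrightarrow> (\<forall>U. open_right_ideal U \<longrightarrow> finite {x\<in>S. f x \<notin> U})"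

text \<open>The row \<open>r\<close> times the matrix with rows \<open>g y\<close>. For
  \<open>g\<close> with values in \<open>R[[X]]\<close> it is the Kleisli extension of
  \<open>g\<close> to a map from \<open>R[[Y]]\<close> to \<open>R[[X]]\<close>.\<close>

definition lin_comb ::
    "'y set \<Rightarrow> ('y \<Rightarrow> 'r) \<Rightarrow> ('y \<Rightarrow> 'x \<Rightarrow> 'r) \<Rightarrow> 'x \<Rightarrow> 'r::{topological_unital_ring, t2_space}" where
  "lin_comb Y r g = (\<lambda>x. \<Sum>\<^sub>\<infinity>y\<in>Y. r y * g y x)"

section \<open>Subgroups, cosets and open right ideals\<close>

lemma add_subgroup_diff: "add_subgroup A \<Longrightarrow> x \<in> A \<Longrightarrow> y \<in> A \<Longrightarrow> x - y \<in> A"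
  unfolding add_subgroup_def by (metis add_uminus_conv_diff)

lemma add_subgroup_sum: "add_subgroup A \<Longrightarrow> (\<And>x. x \<in> F \<Longrightarrow> f x \<in> A) \<Longrightarrow> sum f F \<in> A"
  by (induction F rule: infinite_finite_induct) (auto simp: add_subgroup_def)

lemma sum_subset_diff_mem:
  assumes "add_subgroup U" "finite G" "F \<subseteq> G" "\<And>x. x \<in> G - F \<Longrightarrow> f x \<in> U"
  shows "sum f G - sum f F \<in> U"
  using assms add_subgroup_sum[of U "G - F" f] by (simp add: sum_diff finite_subset)

lemma coset_eq_iff:
  assumes "add_subgroup U"
  shows "coset a U = coset b U \<longleftrightarrow> a - b \<in> U"
proof
  assume "coset a U = coset b U"
  moreover have "a \<in> coset a U" using assms by (auto simp: add_subgroup_def image_iff)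
  ultimately obtain u where "a = b + u" "u \<in> U" by auto
  then show "a - b \<in> U" by simp
next
  assume ab: "a - b \<in> U"
  have *: "coset a U \<subseteq> coset b U" if "a - b \<in> U" for a b :: 'a
  proof
    fix z assume "z \<in> coset a U"
    then obtain u where "u \<in> U" "z = b + (a - b + u)" by (auto simp: algebra_simps)
    moreover from this that assms have "a - b + u \<in> U" by (simp add: add_subgroup_def)
    ultimately show "z \<in> coset b U" by blast
  qed
  have "b - a \<in> U" using ab assms by (metis add_subgroup_def minus_diff_eq)
  with * ab show "coset a U = coset b U" by blast
qed

lemma coset_mono:
  assumes "add_subgroup V" "U \<subseteq> V" "a - b \<in> V"
  shows "coset a U \<subseteq> coset b V"
  using assms coset_eq_iff[of V a b] by blast

lemma open_right_ideal_subgroup: "open_right_ideal U \<Longrightarrow> add_subgroup U"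
  by (simp add: open_right_ideal_def right_ideal_def)

lemma open_right_ideal_0: "open_right_ideal U \<Longrightarrow> 0 \<in> U"
  by (simp add: open_right_ideal_def right_ideal_def add_subgroup_def)

lemma open_right_ideal_mult: "open_right_ideal U \<Longrightarrow> x \<in> U \<Longrightarrow> x * r \<in> U"
  by (simp add: open_right_ideal_def right_ideal_def)

text \<open>Left multiplication by \<open>r\<close> is continuous and commutes with right
  multiplications. This turns smallness of \<open>r * s\<close> modulo \<open>U\<close> into
  smallness of \<open>s\<close>.\<close>

lemma open_right_ideal_vimage:
  assumes "open_right_ideal U"
  shows "open_right_ideal {s. r * s \<in> U}"
proof -
  have "open ((*) r -` U)"
    using assms by (intro open_vimage) (auto simp: open_right_ideal_def intro!: continuous_intros)
  then show ?thesis
    using assms unfolding open_right_ideal_def right_ideal_def add_subgroup_def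
    by (auto simp: vimage_def distrib_left mult.assoc[symmetric])
qed

lemma open_subgroups_UNIV:
  "open_subgroups UNIV = {U :: 'a::{topological_space, ab_group_add} set. add_subgroup U \<and> open U}"
  by (simp add: open_subgroups_def)

lemma zero_convergentD: "zero_convergent f S \<Longrightarrow> open_right_ideal U \<Longrightarrow> finite {x\<in>S. f x \<notin> U}"
  by (simp add: zero_convergent_def)

lemma zero_convergent_subset:
  assumes "zero_convergent f S" "T \<subseteq> S"
  shows "zero_convergent f T"
  unfolding zero_convergent_def
proof (intro allI impI)
  fix U :: "'b set" assume U: "open_right_ideal U"
  show "finite {x\<in>T. f x \<notin> U}"
    by (rule finite_subset[OF _ zero_convergentD[OF assms(1) U]]) (use assms(2) in auto)
qed

text \<open>A right ideal containing \<open>f x\<close> contains \<open>f x * g x\<close>, so the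
  factors \<open>g x\<close> may be arbitrary.\<close>

lemma zero_convergent_mult:
  assumes "zero_convergent f S"
  shows "zero_convergent (\<lambda>x. f x * g x) S"
  unfolding zero_convergent_def
proof (intro allI impI)
  fix U :: "'b set" assume U: "open_right_ideal U"
  have "{x\<in>S. f x * g x \<notin> U} \<subseteq> {x\<in>S. f x \<notin> U}" using open_right_ideal_mult[OF U] by auto
  then show "finite {x\<in>S. f x * g x \<notin> U}"
    using zero_convergentD[OF assms U] by (rule finite_subset)
qed

lemma zero_convergent_diff:
  assumes "zero_convergent f S" "zero_convergent g S"
  shows "zero_convergent (\<lambda>x. f x - g x) S"
  unfolding zero_convergent_def
proof (intro allI impI)
  fix U :: "'b set" assume U: "open_right_ideal U"
  have "{x\<in>S. f x - g x \<notin> U} \<subseteq> {x\<in>S. f x \<notin> U} \<union> {x\<in>S. g x \<notin> U}"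
    using add_subgroup_diff[OF open_right_ideal_subgroup[OF U]] by auto
  then show "finite {x\<in>S. f x - g x \<notin> U}"
    using assms U unfolding zero_convergent_def by (meson finite_UnI finite_subset)
qed

text \<open>The matrix has unit rows. Together with \<open>comb_mult_eq_lin_comb\<close> this
  reduces the contramodule axioms to matrix calculus.\<close>

lemma comb_map_eq_lin_comb: "comb_map X f a = lin_comb X a (\<lambda>x. comb_unit (f x))"
  unfolding comb_map_def lin_comb_def comb_unit_def
  by (intro ext infsum_cong_neutral) auto

lemma comb_mult_eq_lin_comb: "comb_mult X r = lin_comb (formal_combs UNIV X) r (\<lambda>y. y)"
  by (simp add: comb_mult_def lin_comb_def)

lemma lin_comb_cong: "(\<And>y. y \<in> Y \<Longrightarrow> g y = h y) \<Longrightarrow> lin_comb Y r g = lin_comb Y r h"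
  unfolding lin_comb_def by (intro ext infsum_cong) simp

lemma lin_comb_unit_left:
  assumes "y \<in> Y"
  shows "lin_comb Y (comb_unit y) g = g y"
proof
  fix x
  have "lin_comb Y (comb_unit y) g x = (\<Sum>\<^sub>\<infinity>z\<in>{y}. comb_unit y z * g z x)"
    unfolding lin_comb_def using assms by (intro infsum_cong_neutral) (auto simp: comb_unit_def)
  then show "lin_comb Y (comb_unit y) g x = g y x" by (simp add: comb_unit_def)
qed

lemma lin_comb_zero: "lin_comb Y (\<lambda>_. 0) g = (\<lambda>_. 0)"
  by (simp add: lin_comb_def)

section \<open>Sums of zero-convergent families in a complete Hausdorff ring\<close>

locale complete_right_linear_ring =
  fixes ring_type :: "'r::{topological_unital_ring, t2_space} itself"
  assumes base: "base_of_open_right_ideals TYPE('r)"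
    and complete: "complete_group (UNIV :: 'r set)"
begin

lemma open_right_ideal_below:
  fixes W :: "'r set"
  assumes "open W" "0 \<in> W"
  obtains U where "open_right_ideal U" "U \<subseteq> W"
  using assms base unfolding base_of_open_right_ideals_def open_right_ideal_def by blast

text \<open>Some neighborhood of zero misses a nonzero difference, and it contains an open right
  ideal. Equalities of infinite sums are checked modulo each such ideal.\<close>

lemma eq_if_congruent:
  fixes x y :: 'r
  assumes "\<And>U. open_right_ideal U \<Longrightarrow> x - y \<in> U"
  shows "x = y"
proof (rule ccontr)
  assume "x \<noteq> y"
  then have "x - y \<noteq> 0" by simp
  then obtain W where W: "open W" "0 \<in> W" "x - y \<notin> W"
    by (metis t1_space)
  obtain U where "open_right_ideal U" "U \<subseteq> W" using open_right_ideal_below W by blast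
  with assms W show False by blast
qed

lemma zero_convergent_open:
  assumes "zero_convergent f S" "open W" "(0::'r) \<in> W"
  shows "finite {x\<in>S. f x \<notin> W}"
proof -
  obtain U where U: "open_right_ideal U" "U \<subseteq> W" using open_right_ideal_below assms by blast
  then have "finite {x\<in>S. f x \<notin> U}" using assms by (simp add: zero_convergent_def)
  then show ?thesis by (rule finite_subset[rotated]) (use U in auto)
qed

text \<open>Intersecting an open right ideal with \<open>A\<close> gives an open subgroup of
  \<open>A\<close>; conversely, each open subgroup of \<open>A\<close> contains such an
  intersection.\<close>

lemma formal_combs_iff:
  fixes A :: "'r set"
  assumes "add_subgroup A"
  shows "a \<in> formal_combs A X \<longleftrightarrow>
    (\<forall>x\<in>X. a x \<in> A) \<and> (\<forall>x. x \<notin> X \<longrightarrow> a x = 0) \<and> zero_convergent a X"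
proof (intro iffI conjI)
  assume a: "a \<in> formal_combs A X"
  then show "\<forall>x\<in>X. a x \<in> A" "\<forall>x. x \<notin> X \<longrightarrow> a x = 0" by (auto simp: formal_combs_def)
  show "zero_convergent a X"
    unfolding zero_convergent_def
  proof (intro allI impI)
    fix U :: "'r set" assume U: "open_right_ideal U"
    have "A \<inter> U \<in> open_subgroups A"
      using U assms unfolding open_subgroups_def open_right_ideal_def right_ideal_def add_subgroup_def
      by (auto simp: openin_open)
    then have "finite {x\<in>X. a x \<notin> A \<inter> U}" using a unfolding formal_combs_def by blast
    then show "finite {x\<in>X. a x \<notin> U}" by (rule finite_subset[rotated]) auto
  qed
next
  assume a: "(\<forall>x\<in>X. a x \<in> A) \<and> (\<forall>x. x \<notin> X \<longrightarrow> a x = 0) \<and> zero_convergent a X"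
  have "finite {x\<in>X. a x \<notin> V}" if V: "V \<in> open_subgroups A" for V
  proof -
    obtain W where W: "open W" "V = A \<inter> W" using V by (auto simp: open_subgroups_def openin_open)
    moreover have "0 \<in> W" using V W by (auto simp: open_subgroups_def add_subgroup_def)
    ultimately have "finite {x\<in>X. a x \<notin> W}" using zero_convergent_open a by blast
    then show ?thesis by (rule finite_subset[rotated]) (use a W in auto)
  qed
  then show "a \<in> formal_combs A X" using a by (simp add: formal_combs_def)
qed

lemma formal_combs_UNIV_iff:
  fixes a :: "'x \<Rightarrow> 'r"
  shows "a \<in> formal_combs UNIV X \<longleftrightarrow> (\<forall>x. x \<notin> X \<longrightarrow> a x = 0) \<and> zero_convergent a X"
  by (subst formal_combs_iff) (auto simp: add_subgroup_def)

text \<open>Modulo an open subgroup \<open>U\<close> only the finitely many terms in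
  \<open>F U\<close> count. Their sums form a compatible family of cosets, which completeness lifts
  to the element \<open>s\<close>.\<close>

lemma zero_convergent_summable:
  fixes f :: "'x \<Rightarrow> 'r"
  assumes f: "zero_convergent f S"
  shows "f summable_on S"
proof -
  define F where "F U = {x\<in>S. f x \<notin> U}" for U
  have F: "finite (F U)" if "U \<in> open_subgroups UNIV" for U
    unfolding F_def using that zero_convergent_open[OF f]
    by (simp add: open_subgroups_UNIV add_subgroup_def)
  define c where "c = restrict (\<lambda>U. coset (sum f (F U)) U) (open_subgroups UNIV)"
  have "c \<in> quotient_limit UNIV"
    unfolding quotient_limit_def
  proof (intro CollectI conjI ballI impI)
    show "c \<in> (\<Pi>\<^sub>E U\<in>open_subgroups UNIV. range (\<lambda>a. coset a U))"
      by (auto simp: c_def)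
  next
    fix U V :: "'r set"
    assume UV: "U \<in> open_subgroups UNIV" "V \<in> open_subgroups UNIV" "U \<subseteq> V"
    \<comment> \<open>Here \<open>F V\<close> is contained in \<open>F U\<close>, and the additional
      terms lie in \<open>V\<close>.\<close>
    have "sum f (F U) - sum f (F V) \<in> V"
      using UV F[OF UV(1)]
      by (intro sum_subset_diff_mem) (auto simp: F_def open_subgroups_UNIV)
    then have "coset (sum f (F U)) U \<subseteq> coset (sum f (F V)) V"
      using UV by (intro coset_mono) (auto simp: open_subgroups_UNIV)
    then show "c U \<subseteq> c V" using UV by (simp add: c_def)
  qed
  then obtain s where s: "c = to_quotient_limit UNIV s"
    using complete unfolding complete_group_def by blast
  have sF: "sum f (F U) - s \<in> U" if "U \<in> open_subgroups UNIV" for U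
  proof -
    have "coset (sum f (F U)) U = coset s U"
      using fun_cong[OF s, of U] that by (simp add: c_def to_quotient_limit_def)
    moreover have "add_subgroup U" using that by (simp add: open_subgroups_UNIV)
    ultimately show ?thesis by (rule coset_eq_iff[THEN iffD1, rotated])
  qed
  have "(f has_sum s) S"
    unfolding has_sum_def
  proof (rule topological_tendstoI)
    fix W :: "'r set" assume W: "open W" "s \<in> W"
    have "open ((+) s -` W)" using W by (intro open_vimage continuous_intros) auto
    then obtain U where U: "open_right_ideal U" "U \<subseteq> (+) s -` W"
      using open_right_ideal_below[of "(+) s -` W"] W by auto
    then have U': "U \<in> open_subgroups UNIV" "add_subgroup U"
      by (auto simp: open_subgroups_UNIV open_right_ideal_def right_ideal_def)
    have "sum f G \<in> W" if G: "finite G" "F U \<subseteq> G" "G \<subseteq> S" for G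
    proof -
      have "sum f G - sum f (F U) \<in> U"
        using G U' by (intro sum_subset_diff_mem) (auto simp: F_def)
      then have "(sum f G - sum f (F U)) + (sum f (F U) - s) \<in> U"
        using sF U' unfolding add_subgroup_def by blast
      then have "sum f G - s \<in> U" by simp
      then have "s + (sum f G - s) \<in> W" using U by blast
      then show ?thesis by simp
    qed
    then show "\<forall>\<^sub>F G in finite_subsets_at_top S. sum f G \<in> W"
      unfolding eventually_finite_subsets_at_top
      using F[OF U'(1)] by (intro exI[of _ "F U"]) (auto simp: F_def)
  qed
  then show ?thesis by (rule has_sum_imp_summable)
qed

text \<open>Since \<open>U\<close> is open, large finite partial sums are congruent to the infinite
  sum, and terms outside of \<open>F\<close> change a partial sum only by elements of
  \<open>U\<close>.\<close>

lemma infsum_congruent: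
  fixes f :: "'x \<Rightarrow> 'r"
  assumes f: "zero_convergent f S" and U: "open_right_ideal U"
    and F: "finite F" "F \<subseteq> S" "\<And>x. x \<in> S - F \<Longrightarrow> f x \<in> U"
  shows "infsum f S - sum f F \<in> U"
proof -
  have U': "add_subgroup U" "open U" using U by (auto simp: open_right_ideal_def right_ideal_def)
  have "open ((\<lambda>z. infsum f S - z) -` U)"
    using U' by (intro open_vimage continuous_intros) auto
  moreover have "infsum f S \<in> (\<lambda>z. infsum f S - z) -` U"
    using open_right_ideal_0[OF U] by simp
  moreover have "(sum f \<longlongrightarrow> infsum f S) (finite_subsets_at_top S)"
    using has_sum_infsum[OF zero_convergent_summable[OF f]] by (simp add: has_sum_def)
  ultimately have "\<forall>\<^sub>F G in finite_subsets_at_top S. sum f G \<in> (\<lambda>z. infsum f S - z) -` U"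
    by (metis topological_tendstoD)
  then obtain X where X: "finite X" "X \<subseteq> S"
      "\<And>G. finite G \<Longrightarrow> X \<subseteq> G \<Longrightarrow> G \<subseteq> S \<Longrightarrow> infsum f S - sum f G \<in> U"
    unfolding eventually_finite_subsets_at_top by auto
  have "infsum f S - sum f (X \<union> F) \<in> U" using X F by simp
  moreover have "sum f (X \<union> F) - sum f F \<in> U"
    using X F U' by (intro sum_subset_diff_mem) auto
  ultimately have "(infsum f S - sum f (X \<union> F)) + (sum f (X \<union> F) - sum f F) \<in> U"
    using U' unfolding add_subgroup_def by blast
  then show ?thesis by simp
qed

lemma infsum_mem:
  fixes f :: "'x \<Rightarrow> 'r"
  assumes "zero_convergent f S" "open_right_ideal U" "\<And>x. x \<in> S \<Longrightarrow> f x \<in> U"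
  shows "infsum f S \<in> U"
  using infsum_congruent[OF assms(1,2), of "{}"] assms(3) by simp

lemma infsum_mem_closed:
  fixes f :: "'x \<Rightarrow> 'r"
  assumes "zero_convergent f S" "closed A" "add_subgroup A" "\<And>x. x \<in> S \<Longrightarrow> f x \<in> A"
  shows "infsum f S \<in> A"
proof (rule Lim_in_closed_set)
  show "(sum f \<longlongrightarrow> infsum f S) (finite_subsets_at_top S)"
    using has_sum_infsum[OF zero_convergent_summable[OF assms(1)]] by (simp add: has_sum_def)
  show "\<forall>\<^sub>F F in finite_subsets_at_top S. sum f F \<in> A"
    unfolding eventually_finite_subsets_at_top
    using assms by (intro exI[of _ "{}"]) (auto intro!: add_subgroup_sum)
qed (use assms in auto)

lemma infsum_diff:
  fixes f g :: "'x \<Rightarrow> 'r"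
  assumes "zero_convergent f S" "zero_convergent g S"
  shows "infsum (\<lambda>x. f x - g x) S = infsum f S - infsum g S"
proof -
  have "infsum (\<lambda>x. f x + - g x) S = infsum f S + infsum (\<lambda>x. - g x) S"
    using assms by (intro infsum_add) (simp_all add: zero_convergent_summable summable_on_uminus)
  then show ?thesis by (simp add: infsum_uminus)
qed

section \<open>Double families and interchange of summation\<close>

lemma zero_convergent_rectangle:
  fixes f :: "'y \<Rightarrow> 'x \<Rightarrow> 'r"
  assumes "zero_convergent (\<lambda>(y, x). f y x) (Y \<times> X)" "open_right_ideal U"
  obtains F G where "finite F" "F \<subseteq> Y" "finite G" "G \<subseteq> X"
    "\<And>y x. y \<in> Y \<Longrightarrow> x \<in> X \<Longrightarrow> y \<notin> F \<or> x \<notin> G \<Longrightarrow> f y x \<in> U"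
proof -
  define P where "P = {p\<in>Y \<times> X. (case p of (y, x) \<Rightarrow> f y x) \<notin> U}"
  have "finite P" using zero_convergentD[OF assms] by (simp add: P_def)
  then show thesis
    by (intro that[of "fst ` P" "snd ` P"]) (force simp: P_def)+
qed

lemma zero_convergent_swap:
  assumes "zero_convergent (\<lambda>(y, x). f y x :: 'r) (Y \<times> X)"
  shows "zero_convergent (\<lambda>(x, y). f y x) (X \<times> Y)"
  unfolding zero_convergent_def
proof (intro allI impI)
  fix U :: "'r set" assume "open_right_ideal U"
  then have "finite (prod.swap ` {p\<in>Y \<times> X. (case p of (y, x) \<Rightarrow> f y x) \<notin> U})"
    using zero_convergentD[OF assms] by blast
  then show "finite {p\<in>X \<times> Y. (case p of (x, y) \<Rightarrow> f y x) \<notin> U}"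
    by (rule finite_subset[rotated]) force
qed

lemma zero_convergent_row:
  assumes "zero_convergent (\<lambda>(y, x). f y x :: 'r) (Y \<times> X)" "y \<in> Y"
  shows "zero_convergent (f y) X"
  unfolding zero_convergent_def
proof (intro allI impI)
  fix U :: "'r set" assume "open_right_ideal U"
  then have "finite (snd ` {p\<in>Y \<times> X. (case p of (y, x) \<Rightarrow> f y x) \<notin> U})"
    using zero_convergentD[OF assms(1)] by blast
  then show "finite {x\<in>X. f y x \<notin> U}"
    by (rule finite_subset[rotated]) (use assms(2) in force)
qed

lemma zero_convergent_infsum:
  fixes f :: "'y \<Rightarrow> 'x \<Rightarrow> 'r"
  assumes f: "zero_convergent (\<lambda>(y, x). f y x) (Y \<times> X)"
  shows "zero_convergent (\<lambda>y. infsum (f y) X) Y"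
  unfolding zero_convergent_def
proof (intro allI impI)
  fix U :: "'r set" assume U: "open_right_ideal U"
  obtain F G where "finite F" "F \<subseteq> Y" "finite G" "G \<subseteq> X"
    and FG: "\<And>y x. y \<in> Y \<Longrightarrow> x \<in> X \<Longrightarrow> y \<notin> F \<or> x \<notin> G \<Longrightarrow> f y x \<in> U"
    using zero_convergent_rectangle[OF f U] by blast
  have "infsum (f y) X \<in> U" if "y \<in> Y - F" for y
    using that FG by (intro infsum_mem[OF zero_convergent_row[OF f]] U) auto
  then have "{y\<in>Y. infsum (f y) X \<notin> U} \<subseteq> F" by blast
  then show "finite {y\<in>Y. infsum (f y) X \<notin> U}" using \<open>finite F\<close> by (rule finite_subset)
qed

lemma double_infsum_congruent:
  fixes f :: "'y \<Rightarrow> 'x \<Rightarrow> 'r"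
  assumes f: "zero_convergent (\<lambda>(y, x). f y x) (Y \<times> X)" and U: "open_right_ideal U"
    and F: "finite F" "F \<subseteq> Y" and G: "finite G" "G \<subseteq> X"
    and FG: "\<And>y x. y \<in> Y \<Longrightarrow> x \<in> X \<Longrightarrow> y \<notin> F \<or> x \<notin> G \<Longrightarrow> f y x \<in> U"
  shows "infsum (\<lambda>y. infsum (f y) X) Y - (\<Sum>y\<in>F. \<Sum>x\<in>G. f y x) \<in> U"
proof -
  have U': "add_subgroup U" using U by (rule open_right_ideal_subgroup)
  have "infsum (\<lambda>y. infsum (f y) X) Y - (\<Sum>y\<in>F. infsum (f y) X) \<in> U"
    using F FG by (intro infsum_congruent[OF zero_convergent_infsum[OF f] U]
        infsum_mem[OF zero_convergent_row[OF f] U]) auto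
  moreover have "(\<Sum>y\<in>F. infsum (f y) X - (\<Sum>x\<in>G. f y x)) \<in> U"
    using F G FG
    by (intro add_subgroup_sum[OF U'] infsum_congruent[OF zero_convergent_row[OF f] U]) auto
  ultimately have "(infsum (\<lambda>y. infsum (f y) X) Y - (\<Sum>y\<in>F. infsum (f y) X))
      + (\<Sum>y\<in>F. infsum (f y) X - (\<Sum>x\<in>G. f y x)) \<in> U"
    using U' unfolding add_subgroup_def by blast
  then show ?thesis by (simp add: sum_subtractf)
qed

text \<open>Modulo each open right ideal both iterated sums agree with the sum over one finite
  rectangle.\<close>

lemma infsum_swap:
  fixes f :: "'y \<Rightarrow> 'x \<Rightarrow> 'r"
  assumes f: "zero_convergent (\<lambda>(y, x). f y x) (Y \<times> X)"
  shows "(\<Sum>\<^sub>\<infinity>y\<in>Y. \<Sum>\<^sub>\<infinity>x\<in>X. f y x) = (\<Sum>\<^sub>\<infinity>x\<in>X. \<Sum>\<^sub>\<infinity>y\<in>Y. f y x)"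
proof (rule eq_if_congruent)
  fix U :: "'r set" assume U: "open_right_ideal U"
  obtain F G where F: "finite F" "F \<subseteq> Y" and G: "finite G" "G \<subseteq> X"
    and FG: "\<And>y x. y \<in> Y \<Longrightarrow> x \<in> X \<Longrightarrow> y \<notin> F \<or> x \<notin> G \<Longrightarrow> f y x \<in> U"
    using zero_convergent_rectangle[OF f U] by blast
  have "(\<Sum>\<^sub>\<infinity>y\<in>Y. \<Sum>\<^sub>\<infinity>x\<in>X. f y x) - (\<Sum>y\<in>F. \<Sum>x\<in>G. f y x) \<in> U"
    by (rule double_infsum_congruent[OF f U F G FG])
  moreover have "(\<Sum>\<^sub>\<infinity>x\<in>X. \<Sum>\<^sub>\<infinity>y\<in>Y. f y x) - (\<Sum>x\<in>G. \<Sum>y\<in>F. f y x) \<in> U"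
    by (rule double_infsum_congruent[OF zero_convergent_swap[OF f] U G F]) (use FG in auto)
  ultimately show "(\<Sum>\<^sub>\<infinity>y\<in>Y. \<Sum>\<^sub>\<infinity>x\<in>X. f y x) - (\<Sum>\<^sub>\<infinity>x\<in>X. \<Sum>\<^sub>\<infinity>y\<in>Y. f y x) \<in> U"
    using add_subgroup_diff[OF open_right_ideal_subgroup[OF U]] sum.swap[of f G F]
    by fastforce
qed

section \<open>Composition of infinite linear combinations\<close>

text \<open>If \<open>r y \<in> U\<close>, the whole row \<open>y\<close> of products lies in
  \<open>U\<close>. For each of the finitely many other \<open>y\<close>, the set
  \<open>{s. r y * s \<in> U}\<close> is an open right ideal, so finitely many entries of the row
  escape.\<close>

lemma zero_convergent_lin_comb:
  fixes r :: "'y \<Rightarrow> 'r"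
  assumes r: "r \<in> formal_combs UNIV Y" and g: "g \<in> Y \<rightarrow> formal_combs UNIV X"
  shows "zero_convergent (\<lambda>(y, x). r y * g y x) (Y \<times> X)"
  unfolding zero_convergent_def
proof (intro allI impI)
  fix U :: "'r set" assume U: "open_right_ideal U"
  have "{p\<in>Y \<times> X. (case p of (y, x) \<Rightarrow> r y * g y x) \<notin> U}
      \<subseteq> (SIGMA y:{y\<in>Y. r y \<notin> U}. {x\<in>X. g y x \<notin> {s. r y * s \<in> U}})"
    using open_right_ideal_mult[OF U] by auto
  moreover have "finite (SIGMA y:{y\<in>Y. r y \<notin> U}. {x\<in>X. g y x \<notin> {s. r y * s \<in> U}})"
    using r g U open_right_ideal_vimage[OF U]
    by (intro finite_SigmaI zero_convergentD) (auto simp: formal_combs_UNIV_iff)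
  ultimately show "finite {p\<in>Y \<times> X. (case p of (y, x) \<Rightarrow> r y * g y x) \<notin> U}"
    by (rule finite_subset)
qed

lemma lin_comb_mem:
  fixes r :: "'y \<Rightarrow> 'r"
  assumes r: "r \<in> formal_combs UNIV Y" and g: "g \<in> Y \<rightarrow> formal_combs UNIV X"
  shows "lin_comb Y r g \<in> formal_combs UNIV X"
proof -
  have "lin_comb Y r g x = 0" if "x \<notin> X" for x
    unfolding lin_comb_def using g that
    by (intro infsum_0) (auto simp: formal_combs_UNIV_iff Pi_iff)
  then show ?thesis
    using zero_convergent_infsum[OF zero_convergent_swap[OF zero_convergent_lin_comb[OF assms]]]
    by (simp add: formal_combs_UNIV_iff lin_comb_def)
qed

text \<open>The products \<open>r z * g z y\<close> are zero-convergent over pairs, and the right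
  factor \<open>k y x\<close> preserves this, so the two summations may be interchanged.\<close>

lemma lin_comb_assoc:
  fixes r :: "'z \<Rightarrow> 'r"
  assumes r: "r \<in> formal_combs UNIV Z" and g: "g \<in> Z \<rightarrow> formal_combs UNIV Y"
  shows "lin_comb Y (lin_comb Z r g) k = lin_comb Z r (\<lambda>z. lin_comb Y (g z) k)"
proof
  fix x
  have zc: "zero_convergent (\<lambda>(z, y). r z * g z y) (Z \<times> Y)"
    by (rule zero_convergent_lin_comb[OF r g])
  then have "zero_convergent (\<lambda>p. (case p of (z, y) \<Rightarrow> r z * g z y) * k (snd p) x) (Z \<times> Y)"
    by (rule zero_convergent_mult)
  then have zc': "zero_convergent (\<lambda>(z, y). r z * g z y * k y x) (Z \<times> Y)"
    by (simp add: case_prod_unfold)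
  have "lin_comb Y (lin_comb Z r g) k x = (\<Sum>\<^sub>\<infinity>y\<in>Y. (\<Sum>\<^sub>\<infinity>z\<in>Z. r z * g z y) * k y x)"
    by (simp add: lin_comb_def)
  also have "\<dots> = (\<Sum>\<^sub>\<infinity>y\<in>Y. \<Sum>\<^sub>\<infinity>z\<in>Z. r z * g z y * k y x)"
    by (intro infsum_cong infsum_cmult_left[symmetric] zero_convergent_summable
        zero_convergent_row[OF zero_convergent_swap[OF zc]])
  also have "\<dots> = (\<Sum>\<^sub>\<infinity>z\<in>Z. \<Sum>\<^sub>\<infinity>y\<in>Y. r z * g z y * k y x)"
    by (rule infsum_swap[OF zc', symmetric])
  also have "\<dots> = (\<Sum>\<^sub>\<infinity>z\<in>Z. r z * (\<Sum>\<^sub>\<infinity>y\<in>Y. g z y * k y x))"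
    unfolding mult.assoc using g
    by (intro infsum_cong infsum_cmult_right zero_convergent_summable zero_convergent_mult)
      (auto simp: formal_combs_UNIV_iff)
  finally show "lin_comb Y (lin_comb Z r g) k x = lin_comb Z r (\<lambda>z. lin_comb Y (g z) k) x"
    by (simp add: lin_comb_def)
qed

lemma lin_comb_diff:
  fixes r s :: "'y \<Rightarrow> 'r"
  assumes "r \<in> formal_combs UNIV Y" "s \<in> formal_combs UNIV Y"
  shows "lin_comb Y (\<lambda>y. r y - s y) g = (\<lambda>x. lin_comb Y r g x - lin_comb Y s g x)"
  unfolding lin_comb_def left_diff_distrib using assms
  by (intro ext infsum_diff zero_convergent_mult) (auto simp: formal_combs_UNIV_iff)

lemma lin_comb_diff_right:
  fixes r :: "'y \<Rightarrow> 'r"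
  assumes "r \<in> formal_combs UNIV Y"
  shows "lin_comb Y r (\<lambda>y x. g y x - h y x) = (\<lambda>x. lin_comb Y r g x - lin_comb Y r h x)"
  unfolding lin_comb_def right_diff_distrib using assms
  by (intro ext infsum_diff zero_convergent_mult) (auto simp: formal_combs_UNIV_iff)

lemma formal_combs_diff:
  fixes r s :: "'y \<Rightarrow> 'r"
  assumes "r \<in> formal_combs UNIV Y" "s \<in> formal_combs UNIV Y"
  shows "(\<lambda>y. r y - s y) \<in> formal_combs UNIV Y"
  using assms by (auto simp: formal_combs_UNIV_iff intro: zero_convergent_diff)

lemma finite_support_mem_formal_combs:
  fixes f :: "'x \<Rightarrow> 'r"
  assumes "finite F" "F \<subseteq> X" "\<And>x. x \<notin> F \<Longrightarrow> f x = 0"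
  shows "f \<in> formal_combs UNIV X"
  unfolding formal_combs_UNIV_iff zero_convergent_def
proof (intro conjI allI impI)
  fix U :: "'r set" assume "open_right_ideal U"
  then have "f x \<in> U" if "x \<notin> F" for x
    using that assms(3) open_right_ideal_0 by simp
  then have "{x\<in>X. f x \<notin> U} \<subseteq> F" by blast
  then show "finite {x\<in>X. f x \<notin> U}" using assms(1) by (rule finite_subset)
qed (use assms in auto)

lemma comb_unit_mem: "y \<in> Y \<Longrightarrow> (comb_unit y :: 'y \<Rightarrow> 'r) \<in> formal_combs UNIV Y"
  by (rule finite_support_mem_formal_combs[of "{y}"]) (auto simp: comb_unit_def)

lemma lin_comb_unit_right:
  fixes r :: "'y \<Rightarrow> 'r"
  assumes "r \<in> formal_combs UNIV Y"
  shows "lin_comb Y r comb_unit = r"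
proof
  fix x
  show "lin_comb Y r comb_unit x = r x"
  proof (cases "x \<in> Y")
    case True
    have "lin_comb Y r comb_unit x = (\<Sum>\<^sub>\<infinity>y\<in>{x}. r y * comb_unit y x)"
      unfolding lin_comb_def using True by (intro infsum_cong_neutral) (auto simp: comb_unit_def)
    then show ?thesis by (simp add: comb_unit_def)
  next
    case False
    then show ?thesis
      using assms unfolding lin_comb_def comb_unit_def formal_combs_UNIV_iff
      by (auto intro!: infsum_0)
  qed
qed

text \<open>As \<open>comb_map\<close> is a product with unit rows, associativity turns the left
  side into a substitution.\<close>

lemma lin_comb_comb_map:
  fixes r :: "'y \<Rightarrow> 'r"
  assumes "r \<in> formal_combs UNIV Y" "f \<in> Y \<rightarrow> Z"
  shows "lin_comb Z (comb_map Y f r) k = lin_comb Y r (\<lambda>y. k (f y))"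
proof -
  have "lin_comb Z (comb_map Y f r) k = lin_comb Y r (\<lambda>y. lin_comb Z (comb_unit (f y)) k)"
    unfolding comb_map_eq_lin_comb
    using assms by (intro lin_comb_assoc) (auto intro!: comb_unit_mem)
  also have "\<dots> = lin_comb Y r (\<lambda>y. k (f y))"
    using assms by (intro lin_comb_cong lin_comb_unit_left) auto
  finally show ?thesis .
qed

lemma comb_map_mem:
  fixes r :: "'y \<Rightarrow> 'r"
  assumes "r \<in> formal_combs UNIV Y" "f \<in> Y \<rightarrow> Z"
  shows "comb_map Y f r \<in> formal_combs UNIV Z"
  unfolding comb_map_eq_lin_comb using assms by (intro lin_comb_mem) (auto intro!: comb_unit_mem)

end

section \<open>T-nilpotence and paths\<close>

text \<open>Paths are stored backwards: the head of the list is the last vertex. The starting vertex \<open>c\<close> is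
  not part of the list.\<close>

primrec path_prod :: "('x \<Rightarrow> 'x \<Rightarrow> 'r::topological_unital_ring) \<Rightarrow> 'x \<Rightarrow> 'x list \<Rightarrow> 'r" where
  "path_prod h c [] = 1"
| "path_prod h c (x # w) = path_prod h c w * h (hd (w @ [c])) x"

text \<open>Lists run backwards, so \<open>w\<close> is an initial segment of \<open>u @ w\<close>
  and the remaining factors stand on the right. A product inside a right ideal therefore stays there
  when the path is prolonged.\<close>

lemma path_prod_append: "\<exists>s. path_prod h c (u @ w) = path_prod h c w * s"
proof (induction u)
  case Nil
  show ?case by (rule exI[of _ 1]) simp
next
  case (Cons x u)
  then obtain s where "path_prod h c (u @ w) = path_prod h c w * s" by blast
  then have "path_prod h c ((x # u) @ w) = path_prod h c w * (s * h (hd ((u @ w) @ [c])) x)"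
    by (simp add: mult.assoc)
  then show ?case ..
qed

lemma topologically_left_T_nilpotentD:
  assumes "topologically_left_T_nilpotent H" "range a \<subseteq> H" "open U" "0 \<in> U"
  shows "\<exists>n. prod_list (map a [0..<Suc n]) \<in> U"
proof -
  have lim: "limitin (top_of_set H) (\<lambda>n. prod_list (map a [0..<Suc n])) 0 sequentially"
    using assms(1,2) unfolding topologically_left_T_nilpotent_def by blast
  then have "0 \<in> H" by (simp add: limitin_def)
  then have "openin (top_of_set H) (H \<inter> U) \<and> 0 \<in> H \<inter> U"
    using assms(3,4) by (auto simp: openin_open)
  with lim have "\<forall>\<^sub>F n in sequentially. prod_list (map a [0..<Suc n]) \<in> H \<inter> U"
    unfolding limitin_def by blast
  then show ?thesis by (auto dest: eventually_happens simp: eventually_sequentially)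
qed

context complete_right_linear_ring
begin

text \<open>Koenig's lemma: otherwise there is an infinite path all of whose initial products avoid
  \<open>U\<close>, and its entries form a sequence in \<open>H\<close> violating
  T-nilpotence.\<close>

lemma zero_convergent_path_prod:
  fixes h :: "'x \<Rightarrow> 'x \<Rightarrow> 'r"
  assumes H: "topologically_left_T_nilpotent H"
    and h: "h \<in> C \<rightarrow> formal_combs UNIV C" "\<And>x y. x \<in> C \<Longrightarrow> y \<in> C \<Longrightarrow> h x y \<in> H"
    and c: "c \<in> C"
  shows "zero_convergent (path_prod h c) (lists C)"
  unfolding zero_convergent_def
proof (intro allI impI, rule ccontr)
  fix U :: "'r set"
  assume U: "open_right_ideal U"
  define T where "T = {w \<in> lists C. path_prod h c w \<notin> U}"
  assume "infinite {w \<in> lists C. path_prod h c w \<notin> U}"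
  then have inf: "infinite T" by (simp add: T_def)
  \<comment> \<open>The members of \<open>T\<close> that prolong \<open>w\<close>; in particular
    \<open>E [] = T\<close>.\<close>
  define E where "E w = {v\<in>T. \<exists>u. v = u @ w}" for w
  have hd_mem: "hd (w @ [c]) \<in> C" if "w \<in> lists C" for w
    using that c by (cases w) auto
  \<comment> \<open>Products outside of the right ideal \<open>U\<close> have all their initial products outside of \<open>U\<close>, so
    \<open>T\<close> is a tree, and it is finitely branching since the rows of \<open>h\<close> are zero-convergent.\<close>
  have step: "\<exists>x\<in>C. infinite (E (x # w))" if w: "w \<in> lists C" "infinite (E w)" for w
  proof (rule ccontr)
    assume fin: "\<not> (\<exists>x\<in>C. infinite (E (x # w)))"
    \<comment> \<open>The vertices that can follow \<open>w\<close> with the product still outside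
      of \<open>U\<close>.\<close>
    define B where "B = {x\<in>C. h (hd (w @ [c])) x \<notin> {s. path_prod h c w * s \<in> U}}"
    have "finite B"
      unfolding B_def using h(1) hd_mem[OF w(1)]
      by (intro zero_convergentD open_right_ideal_vimage U) (auto simp: formal_combs_UNIV_iff)
    have "E w \<subseteq> insert w (\<Union>x\<in>B. E (x # w))"
    proof
      fix v assume v: "v \<in> E w"
      then obtain u where u: "v = u @ w" "v \<in> T" by (auto simp: E_def)
      show "v \<in> insert w (\<Union>x\<in>B. E (x # w))"
      proof (cases u rule: rev_cases)
        case (snoc u' x)
        then have vx: "v = u' @ (x # w)" using u by simp
        then have "path_prod h c (x # w) \<notin> U"
          using u(2) path_prod_append[of h c u' "x # w"] open_right_ideal_mult[OF U]
          by (auto simp: T_def)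
        then have "x \<in> B" using u(2) vx by (auto simp: B_def T_def)
        then show ?thesis using u(2) vx by (auto simp: E_def)
      qed (use u in simp)
    qed
    moreover have "finite (insert w (\<Union>x\<in>B. E (x # w)))"
      using \<open>finite B\<close> fin by (auto simp: B_def)
    ultimately show False using w(2) finite_subset by blast
  qed
  \<comment> \<open>The clause for \<open>n = 0\<close> makes the branch start at the empty
    path.\<close>
  have "\<exists>W. \<forall>n. (W n \<in> lists C \<and> infinite (E (W n)) \<and> (n = 0 \<longrightarrow> W n = []))
      \<and> (\<exists>x\<in>C. W (Suc n) = x # W n)"
  proof (rule dependent_nat_choice)
    show "\<exists>w. w \<in> lists C \<and> infinite (E w) \<and> (0 = (0::nat) \<longrightarrow> w = [])"
      using inf by (intro exI[of _ "[]"]) (simp add: E_def)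
  next
    fix w n
    assume w: "w \<in> lists C \<and> infinite (E w) \<and> (n = (0::nat) \<longrightarrow> w = [])"
    then obtain x where "x \<in> C" "infinite (E (x # w))" using step by blast
    with w show "\<exists>w'. (w' \<in> lists C \<and> infinite (E w') \<and> (Suc n = 0 \<longrightarrow> w' = []))
        \<and> (\<exists>x\<in>C. w' = x # w)"
      by (intro exI[of _ "x # w"]) auto
  qed
  then obtain W where W: "W 0 = []" "\<And>n. W n \<in> lists C" "\<And>n. infinite (E (W n))"
      "\<And>n. \<exists>x\<in>C. W (Suc n) = x # W n"
    by metis
  \<comment> \<open>The vertex reached after \<open>n\<close> steps; \<open>y 0 = c\<close> because
    \<open>W 0\<close> is empty.\<close>
  define y where "y n = hd (W n @ [c])" for n
  define a where "a n = h (y n) (y (Suc n))" for n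
  have W_Suc: "W (Suc n) = y (Suc n) # W n" for n using W(4)[of n] by (auto simp: y_def)
  have prod: "prod_list (map a [0..<n]) = path_prod h c (W n)" for n
  proof (induction n)
    case (Suc n)
    then show ?case by (simp add: W_Suc) (simp add: a_def y_def)
  qed (simp add: W(1))
  have "path_prod h c (W n) \<notin> U" for n
  proof -
    have "E (W n) \<noteq> {}" using W(3)[of n] by (metis finite.emptyI)
    then obtain u where "path_prod h c (u @ W n) \<notin> U" by (auto simp: E_def T_def)
    then show ?thesis using path_prod_append[of h c u "W n"] open_right_ideal_mult[OF U] by auto
  qed
  moreover have "range a \<subseteq> H"
    using h(2) hd_mem[OF W(2)] by (auto simp: a_def y_def)
  then have "\<exists>n. prod_list (map a [0..<Suc n]) \<in> U"
    using U open_right_ideal_0[OF U]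
    by (intro topologically_left_T_nilpotentD[OF H]) (auto simp: open_right_ideal_def)
  ultimately show False unfolding prod by blast
qed

text \<open>A nonempty path ending at \<open>x\<close> is a shorter path followed by a step to
  \<open>x\<close>. Summing path products by last vertex thus gives \<open>A h\<close> plus the
  contribution \<open>comb_unit c\<close> of the empty path.\<close>

lemma path_prod_fixpoint:
  fixes h :: "'x \<Rightarrow> 'x \<Rightarrow> 'r"
  assumes zc: "zero_convergent (path_prod h c) (lists C)"
    and h: "h \<in> C \<rightarrow> formal_combs UNIV C" and c: "c \<in> C"
  obtains A where "A \<in> formal_combs UNIV C" "\<And>x. A x - lin_comb C A h x = comb_unit c x"
proof -
  define P where "P w = (if w \<in> lists C then path_prod h c w else 0)" for w
  define t where "t w = hd (w @ [c])" for w
  \<comment> \<open>\<open>A x\<close> is the sum of the products along all paths ending at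
    \<open>x\<close>.\<close>
  define A where "A = comb_map (lists C) t P"
  have "{x \<in> lists C. P x \<notin> U} = {x \<in> lists C. path_prod h c x \<notin> U}" for U
    by (auto simp: P_def)
  then have P: "P \<in> formal_combs UNIV (lists C)"
    using zc by (simp add: formal_combs_UNIV_iff zero_convergent_def) (simp add: P_def)
  have t: "t w \<in> C" if "w \<in> lists C" for w
    using that c by (cases w) (auto simp: t_def)
  have A: "A \<in> formal_combs UNIV C"
    unfolding A_def using P t by (intro comb_map_mem) auto
  have A': "lin_comb C A h \<in> formal_combs UNIV C"
    using A h by (rule lin_comb_mem)
  have "A x = comb_unit c x + lin_comb C A h x" for x
  proof (cases "x \<in> C")
    case False
    then show ?thesis using A A' c by (auto simp: formal_combs_UNIV_iff comb_unit_def)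
  next
    case True
    have "lin_comb C A h x = (\<Sum>\<^sub>\<infinity>w\<in>lists C. P w * h (t w) x)"
      unfolding A_def using P t by (subst lin_comb_comb_map) (auto simp: lin_comb_def)
    \<comment> \<open>Prolonging a path by \<open>x\<close> multiplies its product on the right by
      the entry of \<open>h\<close> from its last vertex to \<open>x\<close>.\<close>
    also have "\<dots> = (\<Sum>\<^sub>\<infinity>w\<in>lists C. (P \<circ> Cons x) w)"
      using True by (intro infsum_cong) (auto simp: P_def t_def)
    also have "\<dots> = infsum P (Cons x ` lists C)"
      by (subst infsum_reindex) (auto simp: comp_def)
    finally have lin: "lin_comb C A h x = infsum P (Cons x ` lists C)" .
    show ?thesis
    proof (cases "x = c")
      case True
      have "{w \<in> lists C. t w = x} = insert [] (Cons x ` lists C)"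
      proof (intro set_eqI)
        fix w show "w \<in> {w \<in> lists C. t w = x} \<longleftrightarrow> w \<in> insert [] (Cons x ` lists C)"
          using True c by (cases w) (auto simp: t_def)
      qed
      moreover have "P summable_on Cons x ` lists C"
        by (rule zero_convergent_summable[OF zero_convergent_subset[of P "lists C"]])
          (use P \<open>x \<in> C\<close> in \<open>auto simp: formal_combs_UNIV_iff\<close>)
      ultimately have "A x = P [] + infsum P (Cons x ` lists C)"
        by (simp add: A_def comb_map_def infsum_insert image_iff)
      then show ?thesis using True lin by (simp add: P_def comb_unit_def)
    next
      case False
      have "{w \<in> lists C. t w = x} = Cons x ` lists C"
      proof (intro set_eqI)
        fix w show "w \<in> {w \<in> lists C. t w = x} \<longleftrightarrow> w \<in> Cons x ` lists C"
          using False \<open>x \<in> C\<close> by (cases w) (auto simp: t_def)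
      qed
      then show ?thesis using False lin by (simp add: A_def comb_map_def comb_unit_def)
    qed
  qed
  then show thesis using A by (intro that[of A]) auto
qed

text \<open>A Nakayama argument: the contraaction cannot tell \<open>x\<close> from
  \<open>h x\<close>, whose coefficients lie in \<open>H\<close>, while the geometric series of
  \<open>h\<close> exists by T-nilpotence.\<close>

lemma contra_image_eq_imp_zero:
  fixes H :: "'r set"
  assumes H: "topologically_left_T_nilpotent H" "add_subgroup H"
    and C: "left_contramodule C p" "contra_image H C p = C"
  shows "C = {p (\<lambda>_. 0)}"
proof -
  let ?F = "formal_combs UNIV C :: ('a \<Rightarrow> 'r) set"
  have p: "p \<in> ?F \<rightarrow> C" and p_unit: "\<And>x. x \<in> C \<Longrightarrow> p (comb_unit x) = x"
    and p_assoc: "\<And>r. r \<in> formal_combs UNIV ?F \<Longrightarrow> p (comb_mult C r) = p (comb_map ?F p r)"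
    using C(1) by (auto simp: left_contramodule_def)
  have "\<exists>u\<in>formal_combs H C. p u = x" if "x \<in> C" for x
  proof -
    have "x \<in> contra_image H C p" using that C(2) by simp
    then show ?thesis by (auto simp: contra_image_def)
  qed
  then obtain h where h: "\<And>x. x \<in> C \<Longrightarrow> h x \<in> formal_combs H C" "\<And>x. x \<in> C \<Longrightarrow> p (h x) = x"
    by metis
  have hF: "h \<in> C \<rightarrow> ?F" and hH: "\<And>x y. x \<in> C \<Longrightarrow> y \<in> C \<Longrightarrow> h x y \<in> H"
    using h(1) by (auto simp: formal_combs_iff[OF H(2)] formal_combs_UNIV_iff)
  have eF: "comb_unit \<in> C \<rightarrow> ?F" by (auto intro: comb_unit_mem)
  have "c = p (\<lambda>_. 0)" if c: "c \<in> C" for c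
  proof -
    obtain A where A: "A \<in> ?F" "\<And>x. A x - lin_comb C A h x = comb_unit c x"
      using path_prod_fixpoint[OF zero_convergent_path_prod[OF H(1) hF hH c] hF c] by blast
    \<comment> \<open>The coefficients of \<open>A\<close> are placed at the points
      \<open>comb_unit z\<close>, minus the same at \<open>h z\<close>. Opening parentheses yields
      \<open>A - A h\<close>, that is \<open>comb_unit c\<close>; applying \<open>p\<close> inside
      yields zero, since \<open>p\<close> sends both points to \<open>z\<close>.\<close>
    define r where "r = (\<lambda>u. comb_map C comb_unit A u - comb_map C h A u)"
    have eA: "comb_map C comb_unit A \<in> formal_combs UNIV ?F"
      and hA: "comb_map C h A \<in> formal_combs UNIV ?F"
      using A(1) eF hF by (auto intro: comb_map_mem)
    have r: "r \<in> formal_combs UNIV ?F"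
      unfolding r_def by (rule formal_combs_diff[OF eA hA])
    \<comment> \<open>Taking for \<open>k\<close> the identity gives \<open>comb_mult\<close>, and
      \<open>comb_unit\<close> after \<open>p\<close> gives \<open>comb_map\<close>.\<close>
    have lin_r: "lin_comb ?F r k x
        = lin_comb C A (\<lambda>z. k (comb_unit z)) x - lin_comb C A (\<lambda>z. k (h z)) x"
      for k :: "('a \<Rightarrow> 'r) \<Rightarrow> 'a \<Rightarrow> 'r" and x
      unfolding r_def lin_comb_diff[OF eA hA]
      by (simp add: lin_comb_comb_map[OF A(1) eF] lin_comb_comb_map[OF A(1) hF])
    have "comb_mult C r = comb_unit c"
    proof
      fix x
      have "comb_mult C r x = lin_comb C A comb_unit x - lin_comb C A h x"
        by (simp add: comb_mult_eq_lin_comb lin_r)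
      then show "comb_mult C r x = comb_unit c x"
        using A by (simp add: lin_comb_unit_right)
    qed
    moreover have "comb_map ?F p r = (\<lambda>_. 0)"
    proof
      fix x
      have "lin_comb C A (\<lambda>z. comb_unit (p (comb_unit z))) = lin_comb C A (\<lambda>z. comb_unit (p (h z)))"
        using p_unit h(2) by (intro lin_comb_cong) simp
      then show "comb_map ?F p r x = 0"
        by (simp add: comb_map_eq_lin_comb lin_r)
    qed
    ultimately show ?thesis using p_assoc[OF r] p_unit[OF c] by simp
  qed
  moreover have "p (\<lambda>_. 0) \<in> C"
    using p finite_support_mem_formal_combs[of "{}" C "\<lambda>_. 0"] by auto
  ultimately show ?thesis by blast
qed

section \<open>Cokernels of maps between free contramodules\<close>

text \<open>For rows \<open>b y\<close> in \<open>R[[X]]\<close> this is congruence modulo the image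
  of the induced map from \<open>R[[Y]]\<close> to \<open>R[[X]]\<close>.\<close>

definition cokernel_cong ::
    "'y set \<Rightarrow> ('y \<Rightarrow> 'x \<Rightarrow> 'r) \<Rightarrow> ('x \<Rightarrow> 'r) \<Rightarrow> ('x \<Rightarrow> 'r) \<Rightarrow> bool" where
  "cokernel_cong Y b u v \<longleftrightarrow> (\<exists>k\<in>formal_combs UNIV Y. (\<lambda>x. u x - v x) = lin_comb Y k b)"

text \<open>Chosen representatives stand for the classes, so that elements of the quotient stay in
  the type of \<open>R[[X]]\<close>.\<close>

definition cokernel_rep ::
    "'x set \<Rightarrow> 'y set \<Rightarrow> ('y \<Rightarrow> 'x \<Rightarrow> 'r) \<Rightarrow> ('x \<Rightarrow> 'r) \<Rightarrow> ('x \<Rightarrow> 'r)" where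
  "cokernel_rep X Y b u = (SOME v. v \<in> formal_combs UNIV X \<and> cokernel_cong Y b u v)"

lemma zero_mem_formal_combs: "(\<lambda>_. 0 :: 'r) \<in> formal_combs UNIV X"
  by (rule finite_support_mem_formal_combs[of "{}"]) auto

lemma cokernel_cong_refl: "cokernel_cong Y b u u"
  unfolding cokernel_cong_def
  by (rule bexI[OF _ zero_mem_formal_combs]) (simp add: lin_comb_zero)

text \<open>Subtract the two combinations of relations. With reflexivity this yields symmetry and
  transitivity.\<close>

lemma cokernel_cong_euclidean:
  assumes "cokernel_cong Y b u w" "cokernel_cong Y b v w"
  shows "cokernel_cong Y b u v"
proof -
  obtain k l where kl: "k \<in> formal_combs UNIV Y" "(\<lambda>x. u x - w x) = lin_comb Y k b"
      "l \<in> formal_combs UNIV Y" "(\<lambda>x. v x - w x) = lin_comb Y l b"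
    using assms by (auto simp: cokernel_cong_def)
  have "(\<lambda>x. u x - v x) = (\<lambda>x. (u x - w x) - (v x - w x))" by simp
  also have "\<dots> = lin_comb Y (\<lambda>y. k y - l y) b"
    using kl by (simp add: lin_comb_diff fun_eq_iff)
  finally show ?thesis
    unfolding cokernel_cong_def using formal_combs_diff[OF kl(1,3)] by blast
qed

lemma cokernel_cong_sym: "cokernel_cong Y b u v \<Longrightarrow> cokernel_cong Y b v u"
  using cokernel_cong_euclidean cokernel_cong_refl by blast

lemma cokernel_rep:
  assumes "u \<in> formal_combs UNIV X"
  shows "cokernel_rep X Y b u \<in> formal_combs UNIV X" "cokernel_cong Y b u (cokernel_rep X Y b u)"
proof -
  have "cokernel_rep X Y b u \<in> formal_combs UNIV X \<and> cokernel_cong Y b u (cokernel_rep X Y b u)"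
    unfolding cokernel_rep_def by (rule someI[of _ u]) (simp add: assms cokernel_cong_refl)
  then show "cokernel_rep X Y b u \<in> formal_combs UNIV X"
    "cokernel_cong Y b u (cokernel_rep X Y b u)" by auto
qed

lemma cokernel_rep_eq_iff:
  assumes "u \<in> formal_combs UNIV X" "v \<in> formal_combs UNIV X"
  shows "cokernel_rep X Y b u = cokernel_rep X Y b v \<longleftrightarrow> cokernel_cong Y b u v"
proof
  assume "cokernel_rep X Y b u = cokernel_rep X Y b v"
  then show "cokernel_cong Y b u v"
    using cokernel_rep(2)[OF assms(1), of Y b] cokernel_rep(2)[OF assms(2), of Y b]
    by (auto intro: cokernel_cong_euclidean)
next
  assume uv: "cokernel_cong Y b u v"
  \<comment> \<open>Congruent elements define the same predicate, so \<open>SOME\<close> makes the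
    same choice for both.\<close>
  have "cokernel_cong Y b u = cokernel_cong Y b v"
    using uv cokernel_cong_sym[OF uv]
    by (intro ext) (blast intro: cokernel_cong_euclidean cokernel_cong_sym)
  then show "cokernel_rep X Y b u = cokernel_rep X Y b v" by (simp add: cokernel_rep_def)
qed

text \<open>By associativity the relations chosen for the individual \<open>z\<close> combine into
  one with coefficients \<open>lin_comb Z r k\<close>. This is what lets the contraaction descend to
  the quotient.\<close>

lemma cokernel_cong_lin_comb:
  fixes r :: "'z \<Rightarrow> 'r"
  assumes r: "r \<in> formal_combs UNIV Z" and gh: "\<And>z. z \<in> Z \<Longrightarrow> cokernel_cong Y b (g z) (h z)"
  shows "cokernel_cong Y b (lin_comb Z r g) (lin_comb Z r h)"
proof -
  have "\<forall>z\<in>Z. \<exists>k. k \<in> formal_combs UNIV Y \<and> (\<lambda>x. g z x - h z x) = lin_comb Y k b"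
    using gh by (auto simp: cokernel_cong_def)
  from bchoice[OF this] obtain k where k: "k \<in> Z \<rightarrow> formal_combs UNIV Y"
      "\<And>z. z \<in> Z \<Longrightarrow> (\<lambda>x. g z x - h z x) = lin_comb Y (k z) b"
    by blast
  have "(\<lambda>x. lin_comb Z r g x - lin_comb Z r h x) = lin_comb Z r (\<lambda>z x. g z x - h z x)"
    by (rule lin_comb_diff_right[OF r, symmetric])
  also have "\<dots> = lin_comb Z r (\<lambda>z. lin_comb Y (k z) b)"
    by (rule lin_comb_cong) (rule k(2))
  also have "\<dots> = lin_comb Y (lin_comb Z r k) b"
    by (rule lin_comb_assoc[OF r k(1), symmetric])
  finally show ?thesis
    unfolding cokernel_cong_def using lin_comb_mem[OF r k(1)] by blast
qed

text \<open>The map \<open>j\<close> only moves the representatives into the type that is to contain the carrier.\<close>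

lemma cokernel_contramodule:
  fixes j :: "('x \<Rightarrow> 'r) \<Rightarrow> 'c" and b :: "'y \<Rightarrow> 'x \<Rightarrow> 'r" and X Y
  assumes ij: "\<And>u. i (j u) = u"
  defines "C \<equiv> j ` cokernel_rep X Y b ` formal_combs UNIV X"
  defines "p \<equiv> \<lambda>f. j (cokernel_rep X Y b (lin_comb C f i))"
  shows "left_contramodule C p"
  unfolding left_contramodule_def
proof (intro conjI ballI)
  let ?F = "formal_combs UNIV C :: ('c \<Rightarrow> 'r) set"
  have i: "i \<in> C \<rightarrow> formal_combs UNIV X"
    by (auto simp: C_def ij cokernel_rep(1))
  show p: "p \<in> ?F \<rightarrow> C"
    using i by (auto simp: p_def C_def intro!: imageI lin_comb_mem)
  show "p (comb_unit x) = x" if x: "x \<in> C" for x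
  proof -
    obtain u where u: "u \<in> formal_combs UNIV X" "x = j (cokernel_rep X Y b u)"
      using x by (auto simp: C_def)
    have "cokernel_rep X Y b (cokernel_rep X Y b u) = cokernel_rep X Y b u"
      using u(1) by (simp add: cokernel_rep_eq_iff cokernel_rep cokernel_cong_sym)
    then show ?thesis using x u(2) by (simp add: p_def lin_comb_unit_left ij)
  qed
  fix r :: "('c \<Rightarrow> 'r) \<Rightarrow> 'r" assume r: "r \<in> formal_combs UNIV ?F"
  have "lin_comb C (comb_mult C r) i = lin_comb ?F r (\<lambda>y. lin_comb C y i)"
    unfolding comb_mult_eq_lin_comb by (rule lin_comb_assoc[OF r]) simp
  \<comment> \<open>Here the inner combinations are replaced by representatives before they are
    summed, which changes the result only within its class.\<close>
  moreover have "lin_comb C (comb_map ?F p r) i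
      = lin_comb ?F r (\<lambda>y. cokernel_rep X Y b (lin_comb C y i))"
    by (subst lin_comb_comb_map[OF r p]) (simp add: p_def ij)
  moreover have "cokernel_cong Y b (lin_comb ?F r (\<lambda>y. lin_comb C y i))
      (lin_comb ?F r (\<lambda>y. cokernel_rep X Y b (lin_comb C y i)))"
    using i by (intro cokernel_cong_lin_comb r cokernel_rep lin_comb_mem)
  ultimately have "cokernel_cong Y b (lin_comb C (comb_mult C r) i) (lin_comb C (comb_map ?F p r) i)"
    by simp
  moreover have "lin_comb C (comb_mult C r) i \<in> formal_combs UNIV X"
    unfolding comb_mult_eq_lin_comb by (intro lin_comb_mem r i) simp
  moreover have "lin_comb C (comb_map ?F p r) i \<in> formal_combs UNIV X"
    by (intro lin_comb_mem comb_map_mem[OF r p] i)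
  ultimately have "cokernel_rep X Y b (lin_comb C (comb_mult C r) i)
      = cokernel_rep X Y b (lin_comb C (comb_map ?F p r) i)"
    by (simp only: cokernel_rep_eq_iff)
  then show "p (comb_mult C r) = p (comb_map ?F p r)"
    by (simp only: p_def)
qed

section \<open>The contramodule of a sequence\<close>

lemma comb_map_Suc: "comb_map UNIV Suc f m = (case m of 0 \<Rightarrow> 0 | Suc n \<Rightarrow> f n)"
  by (auto simp: comb_map_def split: nat.split)

text \<open>The embedding \<open>j\<close> with left inverse \<open>i\<close> makes room in
  \<open>'c\<close> for a quotient of \<open>R[[nat]]\<close>. That quotient equals its image under
  \<open>H\<close>, so it is zero.\<close>

lemma T_nilpotent_if_contra_image_neq:
  fixes H :: "'r set"
  assumes H: "left_ideal H" "closed H"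
    and C: "\<And>(C :: 'c set) (p :: ('c \<Rightarrow> 'r) \<Rightarrow> 'c). left_contramodule C p \<Longrightarrow> nonzero_contramodule C p \<Longrightarrow>
      contra_image H C p \<noteq> C"
    and ij: "\<And>u :: nat \<Rightarrow> 'r. i (j u :: 'c) = u"
  shows "topologically_left_T_nilpotent H"
  unfolding topologically_left_T_nilpotent_def
proof (intro allI impI)
  fix a :: "nat \<Rightarrow> 'r" assume a: "range a \<subseteq> H"
  have H': "add_subgroup H" "\<And>r x. x \<in> H \<Longrightarrow> r * x \<in> H"
    using H(1) by (auto simp: left_ideal_def)
  let ?N = "formal_combs UNIV (UNIV :: nat set) :: (nat \<Rightarrow> 'r) set"
  \<comment> \<open>Row \<open>n\<close> is the relation \<open>e(n) - a(n) e(n+1)\<close>.\<close>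
  define b where "b n m = comb_unit n m - a n * comb_unit (Suc n) m" for n m :: nat
  define rep where "rep = cokernel_rep (UNIV :: nat set) (UNIV :: nat set) b"
  define C where "C = j ` rep ` ?N"
  define p where "p f = j (rep (lin_comb C f i))" for f
  have contra: "left_contramodule C p"
    unfolding C_def p_def rep_def using ij by (rule cokernel_contramodule)
  have ka: "(\<lambda>n. k n * a n) \<in> ?N" if "k \<in> ?N" for k
    using that by (simp add: formal_combs_UNIV_iff zero_convergent_mult)
  have lin_b: "lin_comb UNIV k b = (\<lambda>m. k m - comb_map UNIV Suc (\<lambda>n. k n * a n) m)"
    if k: "k \<in> ?N" for k
  proof -
    have "lin_comb UNIV k b
        = (\<lambda>m. lin_comb UNIV k comb_unit m - lin_comb UNIV k (\<lambda>n m. a n * comb_unit (Suc n) m) m)"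
      unfolding b_def[abs_def] by (rule lin_comb_diff_right[OF k])
    also have "lin_comb UNIV k (\<lambda>n m. a n * comb_unit (Suc n) m)
        = comb_map UNIV Suc (\<lambda>n. k n * a n)"
      by (simp add: comb_map_eq_lin_comb lin_comb_def mult.assoc)
    finally show ?thesis by (simp add: lin_comb_unit_right[OF k])
  qed
  have rep: "rep u \<in> ?N" "cokernel_cong UNIV b u (rep u)" if "u \<in> ?N" for u
    using that by (simp_all add: rep_def cokernel_rep)
  have rep_eq_iff: "rep u = rep v \<longleftrightarrow> cokernel_cong UNIV b u v" if "u \<in> ?N" "v \<in> ?N" for u v
    using that by (simp add: rep_def cokernel_rep_eq_iff)
  have unit: "comb_unit n \<in> ?N" for n by (simp add: comb_unit_mem)
  have i: "i \<in> C \<rightarrow> ?N" by (auto simp: C_def ij rep)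

  have "C \<subseteq> contra_image H C p"
  proof
    fix c assume "c \<in> C"
    then obtain u where u: "u \<in> ?N" "c = j (rep u)" by (auto simp: C_def)
    \<comment> \<open>Modulo the relations, \<open>u\<close> is the combination of the classes of
      \<open>e(n+1)\<close> with coefficients \<open>u n * a n\<close>, which lie in the left ideal
      \<open>H\<close>.\<close>
    define e where "e n = j (rep (comb_unit (Suc n)))" for n
    have e: "e \<in> UNIV \<rightarrow> C" using unit by (auto simp: e_def C_def)
    define f where "f = comb_map UNIV e (\<lambda>n. u n * a n)"
    have fC: "f \<in> formal_combs UNIV C"
      unfolding f_def by (intro comb_map_mem ka u e)
    \<comment> \<open>Several \<open>n\<close> may have the same class \<open>x\<close>, so the
      coefficient is an infinite sum; it stays in \<open>H\<close> because \<open>H\<close> is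
      closed.\<close>
    have "f x \<in> H" for x
      unfolding f_def comb_map_def
    proof (rule infsum_mem_closed[OF _ H(2) H'(1)])
      show "zero_convergent (\<lambda>n. u n * a n) {n \<in> UNIV. e n = x}"
        using ka[OF u(1)] zero_convergent_subset[of "\<lambda>n. u n * a n" UNIV]
        by (simp add: formal_combs_UNIV_iff)
    qed (use a H' in auto)
    then have fH: "f \<in> formal_combs H C"
      using fC by (simp add: formal_combs_iff[OF H'(1)] formal_combs_UNIV_iff)
    have "lin_comb C f i = lin_comb UNIV (\<lambda>n. u n * a n) (\<lambda>n. rep (comb_unit (Suc n)))"
      unfolding f_def lin_comb_comb_map[OF ka[OF u(1)] e] by (simp add: e_def ij)
    moreover have "cokernel_cong UNIV b (comb_map UNIV Suc (\<lambda>n. u n * a n)) \<dots>"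
      unfolding comb_map_eq_lin_comb
      by (intro cokernel_cong_lin_comb ka u rep unit)
    moreover have "cokernel_cong UNIV b u (comb_map UNIV Suc (\<lambda>n. u n * a n))"
      unfolding cokernel_cong_def using u lin_b by auto
    ultimately have "cokernel_cong UNIV b u (lin_comb C f i)"
      by (metis cokernel_cong_euclidean cokernel_cong_sym)
    then have "p f = c"
      using u rep_eq_iff[OF u(1) lin_comb_mem[OF fC i]] by (simp add: p_def)
    then show "c \<in> contra_image H C p" using fH by (auto simp: contra_image_def)
  qed
  moreover have "formal_combs H C \<subseteq> formal_combs UNIV C"
    by (auto simp: formal_combs_iff[OF H'(1)] formal_combs_UNIV_iff)
  then have "contra_image H C p \<subseteq> C"
    using contra by (auto simp: contra_image_def left_contramodule_def)
  ultimately have "\<not> nonzero_contramodule C p" using C[OF contra] by blast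
  then have "C = {p (\<lambda>_. 0)}" by (simp add: nonzero_contramodule_def)
  moreover have "j (rep (comb_unit 0)) \<in> C" "j (rep (\<lambda>_. 0)) \<in> C"
    using unit zero_mem_formal_combs by (auto simp: C_def)
  ultimately have "rep (comb_unit 0) = rep (\<lambda>_. 0)" using ij by (metis singletonD)
  then obtain k where k: "k \<in> ?N" "(\<lambda>m. comb_unit 0 m - 0) = lin_comb UNIV k b"
    using rep_eq_iff[OF unit zero_mem_formal_combs] by (auto simp: cokernel_cong_def)
  have k_eq: "comb_unit 0 m = k m - comb_map UNIV Suc (\<lambda>n. k n * a n) m" for m
    using fun_cong[OF k(2), of m] by (simp add: lin_b[OF k(1)])
  \<comment> \<open>The coefficient at \<open>0\<close> gives \<open>k 0 = 1\<close>, the empty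
    product; the one at \<open>Suc n\<close> gives \<open>k (Suc n) = k n * a n\<close>.\<close>
  have k_prod: "k n = prod_list (map a [0..<n])" for n
  proof (induction n)
    case 0
    show ?case using k_eq[of 0] by (simp add: comb_map_Suc comb_unit_def)
  next
    case (Suc n)
    then show ?case using k_eq[of "Suc n"] by (simp add: comb_map_Suc comb_unit_def)
  qed
  show "limitin (top_of_set H) (\<lambda>n. prod_list (map a [0..<Suc n])) 0 sequentially"
    unfolding limitin_def
  proof (intro conjI allI impI)
    show "0 \<in> topspace (top_of_set H)" using H'(1) by (simp add: add_subgroup_def)
    fix V assume "openin (top_of_set H) V \<and> 0 \<in> V"
    then obtain W where W: "open W" "V = H \<inter> W" "0 \<in> W" by (auto simp: openin_open)
    then have "finite {n\<in>UNIV. k n \<notin> W}"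
      using k(1) by (intro zero_convergent_open) (auto simp: formal_combs_UNIV_iff)
    then obtain m where m: "\<And>n. k n \<notin> W \<Longrightarrow> n < m"
      by (auto simp: finite_nat_set_iff_bounded)
    have "prod_list (map a [0..<Suc n]) \<in> V" if "n \<ge> m" for n
    proof -
      \<comment> \<open>The \<open>n\<close>-th term of the sequence has \<open>Suc n\<close>
        factors, hence the shift of index.\<close>
      have "k (Suc n) \<in> W" using m[of "Suc n"] that by fastforce
      \<comment> \<open>The last factor lies in the left ideal \<open>H\<close>.\<close>
      moreover have "prod_list (map a [0..<Suc n]) \<in> H" using a H' by auto
      ultimately show ?thesis using W by (simp only: k_prod) blast
    qed
    then show "\<forall>\<^sub>F n in sequentially. prod_list (map a [0..<Suc n]) \<in> V"
      by (auto simp: eventually_sequentially)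
  qed
qed

end

theorem lemma6p2:
  fixes H :: "'r::{topological_unital_ring, t2_space} set"
  assumes "base_of_open_right_ideals TYPE('r)"
    and "separated (UNIV :: 'r set)"
    and "complete_group (UNIV :: 'r set)"
    and "left_ideal H"
    and "closed H"
  shows "topologically_left_T_nilpotent H \<longleftrightarrow>
    (\<forall>(C :: ('c, 'r) carrier_type set) (p :: (('c, 'r) carrier_type \<Rightarrow> 'r) \<Rightarrow> ('c, 'r) carrier_type).
      left_contramodule C p \<and> nonzero_contramodule C p \<longrightarrow> contra_image H C p \<noteq> C)"
proof -
  interpret complete_right_linear_ring "TYPE('r)"
    using assms by unfold_locales
  show ?thesis
  proof (intro iffI allI impI)
    fix C :: "('c, 'r) carrier_type set" and p :: "(('c, 'r) carrier_type \<Rightarrow> 'r) \<Rightarrow> ('c, 'r) carrier_type"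
    assume "topologically_left_T_nilpotent H"
      and "left_contramodule C p \<and> nonzero_contramodule C p"
    then show "contra_image H C p \<noteq> C"
      using contra_image_eq_imp_zero[of H C p] assms(4)
      by (auto simp: left_ideal_def nonzero_contramodule_def)
  next
    assume *: "\<forall>(C :: ('c, 'r) carrier_type set) (p :: (('c, 'r) carrier_type \<Rightarrow> 'r) \<Rightarrow> ('c, 'r) carrier_type).
      left_contramodule C p \<and> nonzero_contramodule C p \<longrightarrow> contra_image H C p \<noteq> C"
    show "topologically_left_T_nilpotent H"
    proof (rule T_nilpotent_if_contra_image_neq[OF assms(4,5)])
      show "contra_image H C p \<noteq> C" if "left_contramodule C p" "nonzero_contramodule C p"
        for C :: "('c, 'r) carrier_type set"
          and p :: "(('c, 'r) carrier_type \<Rightarrow> 'r) \<Rightarrow> ('c, 'r) carrier_type"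
        using * that by blast
      \<comment> \<open>The second summand of the carrier type hosts the quotient of
        \<open>R[[nat]]\<close>, with \<open>j = Inr\<close> and \<open>i = projr\<close>.\<close>
      show "projr (Inr u) = u" for u :: "nat \<Rightarrow> 'r" by simp
    qed
  qed
qed

end
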